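(* Let $\phi:\mathbb{P}_1\rightarrow\mathbb{P}_1$ be an endomorphism defined over $\mathbb{Q}$, with good reduction at every non-archimedean place of $\mathbb{Q}$. (1) If $P\in\mathbb{P}_1(\mathbb{Q})$ is a periodic point for $\phi$ with minimal period $n$, then $n\leq 3$. (2) If $P\in\mathbb{P}_1(\mathbb{Q})$ is a preperiodic point for $\phi$, then $|O_\phi(P)|\leq 12$.
   Context: For a prime number $p$, let $\mathbb{Z}_{(p)}$ be the localization of $\mathbb{Z}$ at $p$. An endomorphism $\phi$ of $\mathbb{P}_1$ defined over $\mathbb{Q}$ has good reduction at $p$ if it can be written as $\phi([x:y])=[F(x,y):G(x,y)]$, where $F,G$ are homogeneous polynomials of the same degree with coefficients in $\mathbb{Z}_{(p)}$ whose resultant $\mathrm{Res}(F,G)$ is a unit of $\mathbb{Z}_{(p)}$. A point $P$ is periodic for $\phi$ if $\phi^n(P)=P$ for some $n>0$; the minimal such $n$ is its minimal period. The forward orbit of $P$ is $O_\phi(P)=\{\phi^n(P)\mid n\in\mathbb{N}\}$ (with $\phi^0(P)=P$), and $P$ is preperiodic if $O_\phi(P)$ contains a periodic point, equivalently if $O_\phi(P)$ is finite. *)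

theory Defs
  imports Complex_Main "HOL-Computational_Algebra.Primes" "Subresultants.Resultant_Prelim"
begin

section \<open>The projective line\<close>

definition proj_rel :: "'a::field \<times> 'a \<Rightarrow> 'a \<times> 'a \<Rightarrow> bool" where
  "proj_rel u v \<longleftrightarrow> u \<noteq> (0, 0) \<and> v \<noteq> (0, 0) \<and>
     (\<exists>c. c \<noteq> 0 \<and> fst v = c * fst u \<and> snd v = c * snd u)"

lemma part_equivp_proj_rel: "part_equivp (proj_rel :: 'a::field \<times> 'a \<Rightarrow> _)"
proof (rule part_equivpI)
  have "proj_rel (1, 0) ((1, 0) :: 'a \<times> 'a)"
    unfolding proj_rel_def by (auto intro!: exI[of _ 1])
  then show "\<exists>x :: 'a \<times> 'a. proj_rel x x" ..
next
  show "symp (proj_rel :: 'a \<times> 'a \<Rightarrow> _)"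
  proof (rule sympI)
    fix u v :: "'a \<times> 'a"
    assume "proj_rel u v"
    then obtain c where "u \<noteq> (0, 0)" "v \<noteq> (0, 0)" "c \<noteq> 0"
      "fst v = c * fst u" "snd v = c * snd u"
      unfolding proj_rel_def by blast
    then show "proj_rel v u"
      unfolding proj_rel_def by (auto intro!: exI[of _ "inverse c"])
  qed
next
  show "transp (proj_rel :: 'a \<times> 'a \<Rightarrow> _)"
  proof (rule transpI)
    fix u v w :: "'a \<times> 'a"
    assume "proj_rel u v" "proj_rel v w"
    then obtain c d where "u \<noteq> (0, 0)" "w \<noteq> (0, 0)" "c \<noteq> 0" "d \<noteq> 0"
      "fst v = c * fst u" "snd v = c * snd u" "fst w = d * fst v" "snd w = d * snd v"
      unfolding proj_rel_def by blast
    then show "proj_rel u w"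
      unfolding proj_rel_def by (auto intro!: exI[of _ "d * c"])
  qed
qed

quotient_type (overloaded) 'a P1 = "'a::field \<times> 'a" / partial: proj_rel
  by (rule part_equivp_proj_rel)

text \<open>The point \<open>[x : y]\<close>; the value is meaningful only for \<open>(x, y) \<noteq> (0, 0)\<close>.\<close>

definition proj_point :: "'a::field \<Rightarrow> 'a \<Rightarrow> 'a P1" where
  "proj_point x y = abs_P1 (x, y)"

text \<open>The projective line over \<open>\<rat>\<close> is represented by its complex points, with the rational
  points as a subset.\<close>

definition P1_rational_points :: "complex P1 set" where
  "P1_rational_points = {proj_point (of_rat x) (of_rat y) | x y. (x, y) \<noteq> (0, 0)}"


section \<open>Endomorphisms defined over the rationals\<close>

text \<open>A homogeneous polynomial of degree \<open>d\<close> in \<open>X, Y\<close> with rational coefficients is encoded by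
  the number \<open>d\<close> together with a univariate polynomial \<open>F\<close> of degree at most \<open>d\<close>, the coefficient
  of \<open>X^i Y^(d - i)\<close> being \<open>coeff F i\<close>.\<close>

definition form_eval :: "nat \<Rightarrow> rat poly \<Rightarrow> 'a::field_char_0 \<Rightarrow> 'a \<Rightarrow> 'a" where
  "form_eval d F x y = (\<Sum>i\<le>d. of_rat (coeff F i) * x ^ i * y ^ (d - i))"

definition given_by_forms :: "(complex P1 \<Rightarrow> complex P1) \<Rightarrow> nat \<Rightarrow> rat poly \<Rightarrow> rat poly \<Rightarrow> bool" where
  "given_by_forms \<phi> d F G \<longleftrightarrow> degree F \<le> d \<and> degree G \<le> d \<and>
     (\<forall>x y. (x, y) \<noteq> (0, 0) \<longrightarrow>
        (form_eval d F x y, form_eval d G x y) \<noteq> (0, 0) \<and>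
        \<phi> (proj_point x y) = proj_point (form_eval d F x y) (form_eval d G x y))"

text \<open>Constant maps (\<open>d = 0\<close>) are included.\<close>

definition endomorphism_over_rat :: "(complex P1 \<Rightarrow> complex P1) \<Rightarrow> bool" where
  "endomorphism_over_rat \<phi> \<longleftrightarrow> (\<exists>d F G. given_by_forms \<phi> d F G)"


section \<open>Good reduction\<close>

definition localization_at :: "nat \<Rightarrow> rat set" where
  "localization_at p = {of_int a / of_int b | a b. \<not> int p dvd b}"

definition unit_of_localization_at :: "nat \<Rightarrow> rat \<Rightarrow> bool" where
  "unit_of_localization_at p u \<longleftrightarrow>
     u \<in> localization_at p \<and> (\<exists>v\<in>localization_at p. u * v = 1)"

text \<open>The resultant of two forms of degree \<open>d\<close> is the determinant of the \<open>2d \<times> 2d\<close> Sylvester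
  matrix built with the formal degree \<open>d\<close>. This is \<open>resultant_sub d d\<close>, and not \<open>resultant\<close>, which
  uses the degrees of the univariate polynomials and so ignores vanishing coefficients of
  \<open>X^d\<close>.\<close>

definition good_reduction_at :: "nat \<Rightarrow> (complex P1 \<Rightarrow> complex P1) \<Rightarrow> bool" where
  "good_reduction_at p \<phi> \<longleftrightarrow>
     (\<exists>d F G. given_by_forms \<phi> d F G \<and>
        (\<forall>i. coeff F i \<in> localization_at p) \<and> (\<forall>i. coeff G i \<in> localization_at p) \<and>
        unit_of_localization_at p (resultant_sub d d F G))"


section \<open>Periodic and preperiodic points\<close>

definition periodic_point :: "('a \<Rightarrow> 'a) \<Rightarrow> 'a \<Rightarrow> bool" where
  "periodic_point \<phi> P \<longleftrightarrow> (\<exists>n>0. (\<phi> ^^ n) P = P)"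

definition minimal_period :: "('a \<Rightarrow> 'a) \<Rightarrow> 'a \<Rightarrow> nat" where
  "minimal_period \<phi> P = (LEAST n. n > 0 \<and> (\<phi> ^^ n) P = P)"

definition forward_orbit :: "('a \<Rightarrow> 'a) \<Rightarrow> 'a \<Rightarrow> 'a set" where
  "forward_orbit \<phi> P = {(\<phi> ^^ n) P | n. True}"

definition preperiodic_point :: "('a \<Rightarrow> 'a) \<Rightarrow> 'a \<Rightarrow> bool" where
  "preperiodic_point \<phi> P \<longleftrightarrow> (\<exists>Q\<in>forward_orbit \<phi> P. periodic_point \<phi> Q)"

end

theory Submission
  imports Defs
begin

text \<open>Write the rational points in primitive integer coordinates and let \<open>w(P, Q)\<close> be the absolute value
  of the determinant of the coordinates of \<open>P\<close> and \<open>Q\<close>. Good reduction at every prime gives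
  \<open>w(P, Q) dvd w(\<phi> P, \<phi> Q)\<close>. On a cycle \<open>P\<^sub>0, P\<^sub>1, \<dots>\<close> this makes \<open>w(P\<^sub>i, P\<^sub>j)\<close> depend on \<open>j - i\<close> only,
  and the three-term Pluecker relation among four points of the cycle then excludes the periods 4, 6, 9
  and those prime to 6; every \<open>n > 3\<close> is a multiple of such a number.
  On a tail \<open>P\<^sub>m \<mapsto> \<dots> \<mapsto> P\<^sub>1 \<mapsto> P\<^sub>0\<close> into a fixed point, \<open>w(P\<^sub>b, P\<^sub>a) = w(P\<^sub>b, P\<^sub>0) = d\<^sub>b\<close> for \<open>a < b\<close>, and the
  relation yields \<open>d\<^sub>a = 2 d\<^sub>b\<close> whenever \<open>0 < a < b < m\<close>, so \<open>m \<le> 3\<close>. Applied to \<open>\<phi>\<close> iterated \<open>n\<close> times,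
  where \<open>n \<le> 3\<close> is the period, this bounds the orbit by \<open>4 n \<le> 12\<close>.\<close>

section \<open>Arithmetic behind the excluded periods\<close>

text \<open>Here \<open>c\<close>, \<open>e\<close>, \<open>f\<close> are the distances from a point
  of a 6-cycle to its first three iterates. The second relation forces \<open>f = 2 * c\<close>, the
  first then gives \<open>e = c\<close> because 3 is not a square, and the third fails.\<close>

lemma plucker_6_impossible:
  fixes c e f :: int
  assumes "c > 0" "e > 0" "f > 0" "c dvd e"
    and "c * c = e * e + f * c \<or> e * e = c * c + f * c \<or> f * c = c * c + e * e"
    and "c * e = e * f + e * c \<or> e * f = c * e + e * c \<or> e * c = c * e + e * f"
    and "c * c = f * f + e * e \<or> f * f = c * c + e * e \<or> e * e = c * c + f * f"
  shows False
proof -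
  have "e * f = e * (2 * c)" using assms(1-3,6) by (auto simp: algebra_simps)
  then have f: "f = 2 * c" using \<open>e > 0\<close> by simp
  obtain k where k: "e = c * k" using \<open>c dvd e\<close> ..
  have "k > 0" using k assms(1,2) by (simp add: zero_less_mult_iff)
  have "c * c > 0" "e * e > 0" using assms(1,2) by simp_all
  then have "e * e = c * c \<or> e * e = 3 * (c * c)"
    using assms(5) unfolding f mult.assoc by linarith
  then have "c * c * (k * k) = c * c * 1 \<or> c * c * (k * k) = c * c * 3"
    unfolding k by (simp add: ac_simps)
  then have kk: "k * k = 1 \<or> k * k = 3" using \<open>c > 0\<close> by auto
  have "k < 2"
  proof (rule ccontr)
    assume "\<not> k < 2"
    then have "k * k \<ge> 2 * 2" by (intro mult_mono) auto
    with kk show False by simp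
  qed
  with \<open>k > 0\<close> have "e = c" using k by simp
  then show False using assms(1,7) unfolding f by simp
qed

text \<open>A number divisible by 2 or 3 but by none of 4, 6, 9 is 2 or 3 times a number prime to 6,
  and \<open>n > 3\<close> makes that cofactor exceed 1.\<close>

lemma gt_3_dvd_cases:
  fixes n :: nat
  assumes "n > 3"
  obtains m where "m dvd n" "m = 4 \<or> m = 6 \<or> m = 9 \<or> odd m \<and> \<not> 3 dvd m \<and> m > 1"
proof -
  have "4 dvd n \<or> 6 dvd n \<or> 9 dvd n \<or> odd n \<and> \<not> 3 dvd n \<or>
      even n \<and> \<not> 4 dvd n \<and> \<not> 6 dvd n \<or> 3 dvd n \<and> \<not> 6 dvd n \<and> \<not> 9 dvd n"
    by presburger
  then consider "4 dvd n" | "6 dvd n" | "9 dvd n" | "odd n" "\<not> 3 dvd n"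
    | "even n" "\<not> 4 dvd n" "\<not> 6 dvd n" | "3 dvd n" "\<not> 6 dvd n" "\<not> 9 dvd n"
    by blast
  then show thesis
  proof cases
    case 4
    with assms that[of n] show thesis by simp
  next
    case 5
    then obtain k where "n = 2 * k" by auto
    with 5 assms have "odd k \<and> \<not> 3 dvd k \<and> k > 1" by presburger
    with \<open>n = 2 * k\<close> that[of k] show thesis by simp
  next
    case 6
    then obtain k where "n = 3 * k" by auto
    with 6 assms have "odd k \<and> \<not> 3 dvd k \<and> k > 1" by presburger
    with \<open>n = 3 * k\<close> that[of k] show thesis by simp
  qed (use that assms in auto)
qed

section \<open>Primitive coordinates and nonexpanding maps\<close>

text \<open>The dynamical arguments use the rational points only through these two
  properties.\<close>

locale primitive_coordinates =
  fixes S :: "'a set" and X Y :: "'a \<Rightarrow> int"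
  assumes coprime_coordinates: "P \<in> S \<Longrightarrow> coprime (X P) (Y P)"
    and eq_if_proportional: "\<lbrakk>P \<in> S; Q \<in> S; X P * Y Q = X Q * Y P\<rbrakk> \<Longrightarrow> P = Q"
begin

text \<open>The \<open>p\<close>-adic logarithmic distance of \<open>P\<close> and \<open>Q\<close> is the \<open>p\<close>-adic valuation of
  \<open>wdist P Q\<close>, so \<open>nonexpanding\<close> is nonexpansion for all \<open>p\<close> at once.\<close>

definition wdist :: "'a \<Rightarrow> 'a \<Rightarrow> int" where
  "wdist P Q = \<bar>X P * Y Q - X Q * Y P\<bar>"

definition nonexpanding :: "('a \<Rightarrow> 'a) \<Rightarrow> bool" where
  "nonexpanding f \<longleftrightarrow> (\<forall>P\<in>S. f P \<in> S) \<and> (\<forall>P\<in>S. \<forall>Q\<in>S. wdist P Q dvd wdist (f P) (f Q))"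

lemma wdist_commute: "wdist P Q = wdist Q P"
  unfolding wdist_def by (simp add: abs_minus_commute)

lemma wdist_nonneg: "wdist P Q \<ge> 0"
  unfolding wdist_def by simp

lemma wdist_self [simp]: "wdist P P = 0"
  unfolding wdist_def by simp

lemma wdist_eq_0_iff: "P \<in> S \<Longrightarrow> Q \<in> S \<Longrightarrow> wdist P Q = 0 \<longleftrightarrow> P = Q"
  unfolding wdist_def using eq_if_proportional by auto

lemma wdist_pos: "P \<in> S \<Longrightarrow> Q \<in> S \<Longrightarrow> P \<noteq> Q \<Longrightarrow> wdist P Q > 0"
  using wdist_nonneg[of P Q] wdist_eq_0_iff[of P Q] by linarith

text \<open>The strong triangle inequality at all primes at once. Multiplied by either coordinate of
  \<open>Q\<close>, the determinant of \<open>P\<close> and \<open>R\<close> is a combination of the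
  other two determinants, and the coordinates of \<open>Q\<close> are coprime.\<close>

lemma wdist_ultrametric:
  assumes "Q \<in> S" and "c dvd wdist P Q" and "c dvd wdist Q R"
  shows "c dvd wdist P R"
proof -
  let ?w = "\<lambda>P Q. X P * Y Q - X Q * Y P"
  have c: "c dvd ?w P Q" "c dvd ?w Q R"
    using assms(2,3) unfolding wdist_def by simp_all
  have "X Q * ?w P R = X P * ?w Q R + X R * ?w P Q"
    by (simp add: algebra_simps)
  with c have "c dvd X Q * ?w P R" by simp
  moreover have "Y Q * ?w P R = Y P * ?w Q R + Y R * ?w P Q"
    by (simp add: algebra_simps)
  with c have "c dvd Y Q * ?w P R" by simp
  ultimately have "c dvd gcd (X Q * ?w P R) (Y Q * ?w P R)" by simp
  also have "\<dots> = \<bar>?w P R\<bar>"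
    using coprime_coordinates[OF assms(1)]
    by (simp add: gcd_mult_right coprime_iff_gcd_eq_1 gcd.commute flip: gcd_mult_distrib_int)
  finally show ?thesis unfolding wdist_def .
qed

text \<open>The signed products satisfy a linear relation with coefficients 1, -1, 1; the signs
  decide which absolute value is the sum of the other two.\<close>

lemma plucker:
  "wdist P0 P1 * wdist P2 P3 = wdist P0 P2 * wdist P1 P3 + wdist P0 P3 * wdist P1 P2 \<or>
   wdist P0 P2 * wdist P1 P3 = wdist P0 P1 * wdist P2 P3 + wdist P0 P3 * wdist P1 P2 \<or>
   wdist P0 P3 * wdist P1 P2 = wdist P0 P1 * wdist P2 P3 + wdist P0 P2 * wdist P1 P3"
proof -
  let ?w = "\<lambda>P Q. X P * Y Q - X Q * Y P"
  have "?w P0 P1 * ?w P2 P3 - ?w P0 P2 * ?w P1 P3 + ?w P0 P3 * ?w P1 P2 = 0"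
    by (simp add: algebra_simps)
  then show ?thesis
    unfolding wdist_def abs_mult[symmetric] by linarith
qed

lemma nonexpanding_funpow:
  assumes "nonexpanding f"
  shows "nonexpanding (f ^^ k)"
proof (induction k)
  case 0
  show ?case by (simp add: nonexpanding_def)
next
  case (Suc k)
  then show ?case using assms unfolding nonexpanding_def
    by simp (meson dvd_trans)
qed

lemma nonexpanding_dvd_funpow:
  assumes "nonexpanding f" "P \<in> S" "Q \<in> S"
  shows "wdist P Q dvd wdist ((f ^^ k) P) ((f ^^ k) Q)"
  using nonexpanding_funpow[OF assms(1)] assms(2,3) unfolding nonexpanding_def by blast

lemma funpow_mem:
  assumes "nonexpanding f" "P \<in> S"
  shows "(f ^^ k) P \<in> S"
  using nonexpanding_funpow[OF assms(1)] assms(2) unfolding nonexpanding_def by blast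

text \<open>Moving from \<open>P\<close> in strides of \<open>k\<close>, every stride has length
  divisible by that of the first one, and \<open>wdist_ultrametric\<close> chains the
  strides.\<close>

lemma wdist_dvd_wdist_mult:
  assumes f: "nonexpanding f" and P: "P \<in> S"
  shows "wdist P ((f ^^ k) P) dvd wdist P ((f ^^ (m * k)) P)"
proof (induction m)
  case 0
  show ?case by simp
next
  case (Suc m)
  have "wdist P ((f ^^ k) P) dvd wdist ((f ^^ (m * k)) P) ((f ^^ (m * k)) ((f ^^ k) P))"
    by (intro nonexpanding_dvd_funpow f P funpow_mem)
  also have "(f ^^ (m * k)) ((f ^^ k) P) = (f ^^ (Suc m * k)) P"
    by (metis add.commute comp_apply funpow_add mult_Suc)
  finally show ?case
    using wdist_ultrametric[OF funpow_mem[OF f P] Suc] by blast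
qed

section \<open>Minimal periods\<close>

text \<open>Along a cycle the divisibilities of a nonexpanding map are equalities.\<close>

lemma wdist_cycle:
  assumes f: "nonexpanding f" and P: "P \<in> S" and n: "(f ^^ n) P = P" "n > 0"
  shows "wdist ((f ^^ i) P) ((f ^^ (i + k)) P) = wdist P ((f ^^ k) P)"
proof -
  have per: "(f ^^ (i * n)) Q = Q" if "(f ^^ n) Q = Q" for Q
    using that by (induction i) (simp_all add: funpow_add)
  have shift: "(f ^^ (a + b)) P = (f ^^ a) ((f ^^ b) P)" for a b
    by (simp add: funpow_add)
  have k: "(f ^^ n) ((f ^^ k) P) = (f ^^ k) P"
    using n by (simp add: add.commute flip: shift) (simp add: shift)
  have "wdist P ((f ^^ k) P) dvd wdist ((f ^^ i) P) ((f ^^ i) ((f ^^ k) P))"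
    by (intro nonexpanding_dvd_funpow f P funpow_mem)
  \<comment> \<open>Another \<open>i * n - i\<close> iterations complete \<open>i\<close> full
    turns, so both points return and the chain of divisibilities closes.\<close>
  moreover have "wdist ((f ^^ i) P) ((f ^^ i) ((f ^^ k) P)) dvd
      wdist ((f ^^ (i * n - i)) ((f ^^ i) P)) ((f ^^ (i * n - i)) ((f ^^ i) ((f ^^ k) P)))"
    by (intro nonexpanding_dvd_funpow f P funpow_mem)
  moreover have "(f ^^ (i * n - i)) ((f ^^ i) Q) = Q" if "(f ^^ n) Q = Q" for Q
  proof -
    have "(f ^^ (i * n - i)) ((f ^^ i) Q) = (f ^^ (i * n - i + i)) Q"
      by (simp add: funpow_add)
    also have "i * n - i + i = i * n" using n(2) by simp
    finally show ?thesis using per[OF that] by simp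
  qed
  ultimately show ?thesis
    using n(1) k by (intro zdvd_antisym_nonneg wdist_nonneg) (simp_all add: shift)
qed

lemma wdist_cycle_diff:
  assumes "nonexpanding f" "P \<in> S" "(f ^^ n) P = P" "n > 0" "i \<le> j"
  shows "wdist ((f ^^ i) P) ((f ^^ j) P) = wdist P ((f ^^ (j - i)) P)"
  using wdist_cycle[OF assms(1-4), of i "j - i"] assms(5) by simp

lemma wdist_cycle_flip:
  assumes "nonexpanding f" "P \<in> S" "(f ^^ n) P = P" "n > 0" "k \<le> n"
  shows "wdist P ((f ^^ (n - k)) P) = wdist P ((f ^^ k) P)"
  using wdist_cycle_diff[OF assms] assms(3) wdist_commute[of P "(f ^^ k) P"] by simp

lemma plucker_cycle:
  assumes f: "nonexpanding f" and P: "P \<in> S" and n: "(f ^^ n) P = P" "n > 0"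
    and ij: "a \<le> b" "b \<le> c"
  defines "D \<equiv> \<lambda>k. wdist P ((f ^^ k) P)"
  shows "D a * D (c - b) = D b * D (c - a) + D c * D (b - a) \<or>
         D b * D (c - a) = D a * D (c - b) + D c * D (b - a) \<or>
         D c * D (b - a) = D a * D (c - b) + D b * D (c - a)"
proof -
  note w = wdist_cycle_diff[OF f P n]
  show ?thesis
    using plucker[of P "(f ^^ a) P" "(f ^^ b) P" "(f ^^ c) P"] ij
    by (simp add: D_def w)
qed

text \<open>If \<open>k\<close> divides some \<open>m * n + 1\<close>, then \<open>D k\<close>
  divides \<open>D (m * n + 1) = D 1\<close>, hence equals \<open>D 1\<close>. This applies to
  \<open>k = 2\<close> and \<open>k = 3\<close>, and equal distances violate the Pluecker relation
  for the indices 0, 1, 2, 3.\<close>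

lemma no_period_coprime_6:
  assumes f: "nonexpanding f" and P: "P \<in> S" and n: "(f ^^ n) P = P" and "odd n" "\<not> 3 dvd n"
  shows "f P = P"
proof (rule ccontr)
  assume "f P \<noteq> P"
  define D where "D k = wdist P ((f ^^ k) P)" for k
  have "n > 0" using \<open>odd n\<close> by (rule odd_pos)
  have pos: "D 1 > 0"
    using \<open>f P \<noteq> P\<close> unfolding D_def by (intro wdist_pos P funpow_mem f) auto
  have mult: "D k dvd D (m * k)" for m k
    unfolding D_def by (rule wdist_dvd_wdist_mult[OF f P])
  have iter: "(f ^^ (m * n)) P = P" for m
    using n by (induction m) (simp_all add: funpow_add)
  have mod: "D (m * n + 1) = D 1" for m
    unfolding D_def using iter[of m]
    using wdist_cycle[OF f P n \<open>n > 0\<close>, of "m * n" 1] by simp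
  have eq: "D k = D 1" if "k dvd m * n + 1" for k m
  proof (rule zdvd_antisym_nonneg)
    show "D k dvd D 1" using mult[of k] that mod[of m] by (metis dvd_def mult.commute)
    show "D 1 dvd D k" using mult[of 1 k] by simp
  qed (simp_all add: D_def wdist_nonneg)
  have "D 2 = D 1" using eq[of 2 1] \<open>odd n\<close> by simp
  moreover have "3 dvd n + 1 \<or> 3 dvd 2 * n + 1" using \<open>\<not> 3 dvd n\<close> by presburger
  then have "D 3 = D 1" using eq[of 3 1] eq[of 3 2] by auto
  ultimately show False
    using plucker_cycle[OF f P n \<open>n > 0\<close>, of 1 2 3, folded D_def] pos by simp
qed

text \<open>By the symmetry \<open>D 3 = D 1\<close> the Pluecker relation becomes
  \<open>D 2 * D 2 = 2 * (D 1 * D 1)\<close>; since \<open>D 1 dvd D 2\<close>, this would make 2 a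
  perfect square.\<close>

lemma period_4:
  assumes f: "nonexpanding f" and P: "P \<in> S" and n: "(f ^^ 4) P = P"
  shows "(f ^^ 2) P = P"
proof (rule ccontr)
  assume ne: "(f ^^ 2) P \<noteq> P"
  define D where "D k = wdist P ((f ^^ k) P)" for k
  have "D 2 > 0"
    using ne unfolding D_def by (intro wdist_pos P funpow_mem f) auto
  moreover have "D 3 = D 1"
    unfolding D_def using wdist_cycle_flip[OF f P n, of 1] by simp
  ultimately have sq: "D 2 * D 2 = 2 * (D 1 * D 1)"
    using plucker_cycle[OF f P n, of 1 2 3, folded D_def] by auto
  have "D 1 dvd D 2"
    using wdist_dvd_wdist_mult[OF f P, of 1 2] unfolding D_def by simp
  then obtain e where e: "D 2 = D 1 * e" ..
  with \<open>D 2 > 0\<close> have "D 1 \<noteq> 0" by auto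
  with sq e have "e * e = 2" by simp
  then have "even e" by (metis dvd_refl even_mult_iff)
  then have "4 dvd e * e" by (auto elim!: evenE)
  with \<open>e * e = 2\<close> show False by simp
qed

text \<open>Otherwise \<open>D 2\<close> and \<open>D 3\<close> are positive, and the index sets
  0123, 0124, 0134 yield the three relations of \<open>plucker_6_impossible\<close>.\<close>

lemma period_6:
  assumes f: "nonexpanding f" and P: "P \<in> S" and n: "(f ^^ 6) P = P"
  shows "(f ^^ 3) P = P \<or> (f ^^ 2) P = P"
proof (rule ccontr)
  assume ne: "\<not> ?thesis"
  define D where "D k = wdist P ((f ^^ k) P)" for k
  have D2: "D 2 > 0" and D3: "D 3 > 0"
    unfolding D_def using ne by (metis wdist_pos P funpow_mem f)+
  have "D 4 = D 2"
    unfolding D_def using wdist_cycle_flip[OF f P n, of 2] by simp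
  have dvd: "D 1 dvd D k" for k
    using wdist_dvd_wdist_mult[OF f P, of 1 k] unfolding D_def by simp
  have D1: "D 1 > 0"
    using dvd[of 2] D2 wdist_nonneg[of P "(f ^^ 1) P", folded D_def] by (cases "D 1 = 0") auto
  have "D 1 * D 1 = D 2 * D 2 + D 3 * D 1 \<or> D 2 * D 2 = D 1 * D 1 + D 3 * D 1 \<or>
      D 3 * D 1 = D 1 * D 1 + D 2 * D 2"
    using plucker_cycle[OF f P n, of 1 2 3, folded D_def] by simp
  moreover have "D 1 * D 2 = D 2 * D 3 + D 2 * D 1 \<or> D 2 * D 3 = D 1 * D 2 + D 2 * D 1 \<or>
      D 2 * D 1 = D 1 * D 2 + D 2 * D 3"
    using plucker_cycle[OF f P n, of 1 2 4, folded D_def] \<open>D 4 = D 2\<close> by simp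
  moreover have "D 1 * D 1 = D 3 * D 3 + D 2 * D 2 \<or> D 3 * D 3 = D 1 * D 1 + D 2 * D 2 \<or>
      D 2 * D 2 = D 1 * D 1 + D 3 * D 3"
    using plucker_cycle[OF f P n, of 1 3 4, folded D_def] \<open>D 4 = D 2\<close> by simp
  ultimately show False
    by (rule plucker_6_impossible[OF D1 D2 D3 dvd])
qed

text \<open>Doubling gives a chain of divisibilities from \<open>D 1\<close> through
  \<open>D 2\<close> and \<open>D 4\<close> to \<open>D 8 = D 1\<close>, so these agree. The index
  sets 0123 and 0134 then give \<open>D 3 = 2 * D 1\<close> and
  \<open>D 3 * D 3 = 2 * (D 1 * D 1)\<close>.\<close>

lemma period_9:
  assumes f: "nonexpanding f" and P: "P \<in> S" and n: "(f ^^ 9) P = P"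
  shows "(f ^^ 3) P = P"
proof (rule ccontr)
  assume ne: "\<not> ?thesis"
  define D where "D k = wdist P ((f ^^ k) P)" for k
  have D3: "D 3 > 0"
    unfolding D_def using ne by (metis wdist_pos P funpow_mem f)
  have mult: "D k dvd D (m * k)" for m k
    unfolding D_def by (rule wdist_dvd_wdist_mult[OF f P])
  have "D 1 dvd D 2" "D 2 dvd D 4" "D 4 dvd D 8" "D 1 dvd D 3"
    using mult[of 1 2] mult[of 2 2] mult[of 4 2] mult[of 1 3] by simp_all
  moreover have "D 8 = D 1"
    unfolding D_def using wdist_cycle_flip[OF f P n, of 1] by simp
  ultimately have "D 2 dvd D 1" "D 4 dvd D 1" "D 1 dvd D 2" "D 1 dvd D 4"
    by (metis dvd_trans)+
  then have "D 2 = D 1" "D 4 = D 1"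
    by (simp_all add: zdvd_antisym_nonneg D_def wdist_nonneg)
  have D1: "D 1 > 0"
    using \<open>D 1 dvd D 3\<close> D3 wdist_nonneg[of P "(f ^^ 1) P", folded D_def] by (cases "D 1 = 0") auto
  have "D 1 * D 1 = D 1 * D 1 + D 3 * D 1 \<or> D 3 * D 1 = D 1 * D 1 + D 1 * D 1"
    using plucker_cycle[OF f P n, of 1 2 3, folded D_def] \<open>D 2 = D 1\<close> by auto
  then have "D 3 * D 1 = (2 * D 1) * D 1" using D1 D3 by auto
  then have "D 3 = 2 * D 1" using D1 by simp
  moreover have "D 1 * D 1 = D 3 * D 3 + D 1 * D 1 \<or> D 3 * D 3 = D 1 * D 1 + D 1 * D 1"
    using plucker_cycle[OF f P n, of 1 3 4, folded D_def] \<open>D 2 = D 1\<close> \<open>D 4 = D 1\<close> by auto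
  ultimately show False using D1 by auto
qed

text \<open>With \<open>n = k * m\<close>, the point has minimal period \<open>m\<close> under
  \<open>f ^^ k\<close>, which is again nonexpanding; so only the special values of \<open>m\<close>
  have to be excluded.\<close>

lemma minimal_period_le_3:
  assumes f: "nonexpanding f" and P: "P \<in> S" and n: "(f ^^ n) P = P"
    and min: "\<And>k. 0 < k \<Longrightarrow> k < n \<Longrightarrow> (f ^^ k) P \<noteq> P"
  shows "n \<le> 3"
proof (rule ccontr)
  assume "\<not> n \<le> 3"
  then obtain m where "m dvd n" and
    m: "m = 4 \<or> m = 6 \<or> m = 9 \<or> odd m \<and> \<not> 3 dvd m \<and> m > 1"
    using gt_3_dvd_cases[of n] by auto
  then obtain k where k: "n = k * m" by (auto simp: mult.commute)
  let ?g = "f ^^ k"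
  have "k > 0" using k \<open>\<not> n \<le> 3\<close> by (cases k) auto
  have g: "nonexpanding ?g" by (rule nonexpanding_funpow[OF f])
  have iter: "(?g ^^ j) P = (f ^^ (k * j)) P" for j by (simp add: funpow_mult mult.commute)
  have "(?g ^^ m) P = P" using n k iter by simp
  moreover have ne: "(?g ^^ j) P \<noteq> P" if "0 < j" "j < m" for j
    using min[of "k * j"] that \<open>k > 0\<close> iter k by simp
  ultimately show False
    using m period_4[OF g P] period_6[OF g P] period_9[OF g P] no_period_coprime_6[OF g P, of m]
      ne[of 1] ne[of 2] ne[of 3] by auto
qed

section \<open>Preperiodic tails\<close>

text \<open>In one direction, strides of \<open>k\<close> from \<open>Q\<close> eventually hit
  \<open>Z\<close>. In the other, \<open>wdist Q Z\<close> divides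
  \<open>wdist ((f ^^ k) Q) Z\<close> because \<open>Z\<close> is fixed, and the ultrametric
  property through \<open>Z\<close> applies.\<close>

lemma wdist_tail:
  assumes f: "nonexpanding f" and Q: "Q \<in> S" and Z: "f Z = Z" and N: "(f ^^ N) Q = Z" and k: "k > 0"
  shows "wdist Q ((f ^^ k) Q) = wdist Q Z"
proof (rule zdvd_antisym_nonneg)
  have Zfix: "(f ^^ j) Z = Z" for j by (induction j) (simp_all add: Z)
  have "Z \<in> S" using funpow_mem[OF f Q] N by blast
  \<comment> \<open>\<open>N * k\<close> is a multiple of the stride that is late enough for the
    orbit to have reached \<open>Z\<close>.\<close>
  have "N \<le> N * k" using k by simp
  then have "(f ^^ (N * k)) Q = (f ^^ (N * k - N)) ((f ^^ N) Q)"
    by (metis comp_apply funpow_add le_add_diff_inverse2)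
  then have "(f ^^ (N * k)) Q = Z" by (simp add: N Zfix)
  then show "wdist Q ((f ^^ k) Q) dvd wdist Q Z"
    using wdist_dvd_wdist_mult[OF f Q, of k N] by simp
  have "wdist Q Z dvd wdist ((f ^^ k) Q) Z"
    using nonexpanding_dvd_funpow[OF f Q \<open>Z \<in> S\<close>, of k] Zfix by simp
  then show "wdist Q Z dvd wdist Q ((f ^^ k) Q)"
    using wdist_ultrametric[OF \<open>Z \<in> S\<close>, of _ Q "(f ^^ k) Q"] by (simp add: wdist_commute)
qed (simp_all add: wdist_nonneg)

lemma tail_4:
  assumes f: "nonexpanding f" and P: "P \<in> S" and Z: "f Z = Z" and N: "(f ^^ 4) P = Z"
  shows "(f ^^ 3) P = Z"
proof (rule ccontr)
  assume ne: "(f ^^ 3) P \<noteq> Z"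
  \<comment> \<open>The index counts backwards: \<open>(f ^^ (4 - k)) P\<close> is \<open>k\<close>
    steps away from \<open>Z\<close>.\<close>
  define d where "d k = wdist ((f ^^ (4 - k)) P) Z" for k
  have "Z \<in> S" using funpow_mem[OF f P] N by blast
  have Zfix: "(f ^^ j) Z = Z" for j by (induction j) (simp_all add: Z)
  have comp: "(f ^^ i) ((f ^^ j) P) = (f ^^ (i + j)) P" for i j
    by (simp add: funpow_add)
  have pos: "d k > 0" if "1 \<le> k" "k \<le> 4" for k
  proof -
    have "(f ^^ (k - 1)) ((f ^^ (4 - k)) P) = (f ^^ 3) P"
      unfolding comp using that by simp
    with ne Zfix have "(f ^^ (4 - k)) P \<noteq> Z" by metis
    then show ?thesis unfolding d_def by (intro wdist_pos \<open>Z \<in> S\<close> funpow_mem f P)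
  qed
  have w: "wdist ((f ^^ (4 - a)) P) ((f ^^ (4 - b)) P) = d b" if "a < b" "b \<le> 4" for a b
  proof -
    have "(f ^^ b) ((f ^^ (4 - b)) P) = Z" unfolding comp using that N by simp
    from wdist_tail[OF f funpow_mem[OF f P] Z this, of "b - a"]
    show ?thesis unfolding comp d_def using that by (simp add: wdist_commute)
  qed
  \<comment> \<open>In the Pluecker relation for \<open>Z\<close> and the points with indices
    \<open>a\<close>, \<open>b\<close>, \<open>c\<close>, every product contains \<open>d c\<close>.
    The triples 123, 134, 234 then give \<open>d 1 = 2 * d 2\<close>, \<open>d 1 = 2 * d 3\<close>
    and \<open>d 2 = 2 * d 3\<close>.\<close>
  have double: "d a = 2 * d b" if "1 \<le> a" "a < b" "b < c" "c \<le> 4" for a b c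
  proof -
    have "d a * d c = d b * d c + d c * d b \<or> d b * d c = d a * d c + d c * d b \<or>
        d c * d b = d a * d c + d b * d c"
      using plucker[of Z "(f ^^ (4 - a)) P" "(f ^^ (4 - b)) P" "(f ^^ (4 - c)) P"] that
      by (simp add: w wdist_commute[of Z] flip: d_def)
    then have "d c * d a = d c * (2 * d b)"
      using pos[of a] pos[of c] that by (auto simp: algebra_simps)
    then show ?thesis using pos[of c] that by simp
  qed
  show False
    using double[of 1 2 3] double[of 1 3 4] double[of 2 3 4] pos[of 1] by simp
qed

text \<open>Applying \<open>tail_4\<close> to the point four steps before \<open>Z\<close> shortens
  the tail by one; this repeats until three steps are left.\<close>

lemma tail_le_3:
  assumes f: "nonexpanding f" and P: "P \<in> S" and Z: "f Z = Z" and N: "(f ^^ N) P = Z"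
  shows "(f ^^ 3) P = Z"
proof (cases "N \<le> 3")
  case True
  have Zfix: "(f ^^ j) Z = Z" for j by (induction j) (simp_all add: Z)
  have "(f ^^ 3) P = (f ^^ (3 - N)) ((f ^^ N) P)"
    using True by (metis comp_apply funpow_add le_add_diff_inverse2)
  then show ?thesis by (simp add: N Zfix)
next
  case False
  then have "3 \<le> N" by simp
  then show ?thesis using N
  proof (induction N rule: dec_induct)
    case (step n)
    have comp: "(f ^^ i) ((f ^^ j) P) = (f ^^ (i + j)) P" for i j
      by (simp add: funpow_add)
    have n: "4 + (n - 3) = Suc n" "3 + (n - 3) = n" using \<open>3 \<le> n\<close> by simp_all
    have "(f ^^ 4) ((f ^^ (n - 3)) P) = Z"
      using step.prems by (simp only: comp n)
    then have "(f ^^ 3) ((f ^^ (n - 3)) P) = Z"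
      by (rule tail_4[OF f funpow_mem[OF f P] Z])
    then have "(f ^^ n) P = Z" by (simp only: comp n)
    then show ?case by (rule step.IH)
  qed
qed

end

section \<open>Size of a preperiodic orbit\<close>

lemma minimal_period:
  assumes "periodic_point f P"
  shows "minimal_period f P > 0" "(f ^^ minimal_period f P) P = P"
    "0 < k \<Longrightarrow> k < minimal_period f P \<Longrightarrow> (f ^^ k) P \<noteq> P"
proof -
  let ?Q = "\<lambda>n. n > 0 \<and> (f ^^ n) P = P"
  from assms obtain n where "?Q n" unfolding periodic_point_def by blast
  then have "?Q (minimal_period f P)" unfolding minimal_period_def by (rule LeastI)
  then show "minimal_period f P > 0" "(f ^^ minimal_period f P) P = P" by auto
  show "(f ^^ k) P \<noteq> P" if "0 < k" "k < minimal_period f P"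
    using not_less_Least[of k ?Q] that unfolding minimal_period_def by blast
qed

lemma forward_orbit_subset:
  assumes "(f ^^ (a + n)) P = (f ^^ a) P" "n > 0"
  shows "forward_orbit f P \<subseteq> (\<lambda>j. (f ^^ j) P) ` {..<a + n}"
proof -
  have "(f ^^ j) P \<in> (\<lambda>j. (f ^^ j) P) ` {..<a + n}" for j
  proof (induction j rule: less_induct)
    case (less j)
    show ?case
    proof (cases "j < a + n")
      case False
      define i where "i = j - (a + n)"
      have "(f ^^ j) P = (f ^^ (i + (a + n))) P"
        using False by (simp add: i_def)
      also have "\<dots> = (f ^^ (i + a)) P"
        using assms(1) by (simp add: funpow_add)
      finally show ?thesis
        using less[of "i + a"] False \<open>n > 0\<close> by (simp add: i_def)
    qed auto
  qed
  then show ?thesis unfolding forward_orbit_def by blast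
qed

context primitive_coordinates
begin

lemma card_orbit_le_12:
  assumes f: "nonexpanding f" and P: "P \<in> S" and pre: "preperiodic_point f P"
  shows "finite (forward_orbit f P)" "card (forward_orbit f P) \<le> 12"
proof -
  obtain t where t: "periodic_point f ((f ^^ t) P)"
    using pre unfolding preperiodic_point_def forward_orbit_def by blast
  define n where "n = minimal_period f ((f ^^ t) P)"
  note n = minimal_period[OF t, folded n_def]
  have "n \<le> 3" by (rule minimal_period_le_3[OF f funpow_mem[OF f P] n(2,3)])
  let ?g = "f ^^ n"
  have comp: "(f ^^ i) ((f ^^ j) P) = (f ^^ (i + j)) P" for i j
    by (simp add: funpow_add)
  have iter: "(?g ^^ j) P = (f ^^ (n * j)) P" for j by (simp add: funpow_mult mult.commute)
  \<comment> \<open>Since \<open>n * t \<ge> t\<close>, the point \<open>Z\<close> already lies on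
    the cycle and is fixed by \<open>?g\<close>.\<close>
  define Z where "Z = (?g ^^ t) P"
  have "t \<le> n * t" using n(1) by simp
  then have Z: "Z = (f ^^ (n * t - t)) ((f ^^ t) P)"
    unfolding Z_def iter comp by simp
  have "?g Z = (f ^^ (n * t - t)) (?g ((f ^^ t) P))"
    unfolding Z comp by (simp add: ac_simps)
  then have gZ: "?g Z = Z" using n(2) Z by simp
  have "(?g ^^ 3) P = Z"
    by (rule tail_le_3[OF nonexpanding_funpow[OF f] P gZ]) (simp add: Z_def)
  then have "(f ^^ (3 * n + n)) P = (f ^^ (3 * n)) P"
    using gZ unfolding iter by (metis add.commute comp mult.commute)
  note sub = forward_orbit_subset[OF this n(1)]
  show "finite (forward_orbit f P)"
    using sub by (rule finite_subset) simp
  have "card (forward_orbit f P) \<le> card ((\<lambda>j. (f ^^ j) P) ` {..<3 * n + n})"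
    by (rule card_mono[OF _ sub]) simp
  also have "\<dots> \<le> card {..<3 * n + n}" by (rule card_image_le) simp
  also have "\<dots> \<le> 12" using \<open>n \<le> 3\<close> by simp
  finally show "card (forward_orbit f P) \<le> 12" .
qed

end

section \<open>Binary forms and the Sylvester matrix\<close>

text \<open>The counterpart of \<open>form_eval\<close> with coefficients and values in one ring, so
  that divisibility over the integers makes sense.\<close>

definition hom_eval :: "nat \<Rightarrow> 'a::comm_ring_1 poly \<Rightarrow> 'a \<Rightarrow> 'a \<Rightarrow> 'a" where
  "hom_eval d F x y = (\<Sum>i\<le>d. coeff F i * x ^ i * y ^ (d - i))"

lemma diff_dvd_diff_powers: "(x - y :: 'a::comm_ring_1) dvd x ^ n - y ^ n"
  by (simp add: power_diff_sumr2)

text \<open>After removing common factors, \<open>(x * y') ^ k - (x' * y) ^ k\<close> with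
  \<open>k = j - i\<close> remains.\<close>

lemma monomial_cross_dvd:
  fixes x y x' y' :: "'a::comm_ring_1"
  assumes "i \<le> j" "j \<le> d"
  shows "(x * y' - x' * y) dvd
    x ^ i * y ^ (d - i) * (x' ^ j * y' ^ (d - j)) - x' ^ i * y' ^ (d - i) * (x ^ j * y ^ (d - j))"
proof -
  define k l where "k = j - i" and "l = d - j"
  have jd: "j = i + k" "d = i + k + l" using assms by (simp_all add: k_def l_def)
  have "x ^ i * y ^ (d - i) * (x' ^ j * y' ^ (d - j)) - x' ^ i * y' ^ (d - i) * (x ^ j * y ^ (d - j)) =
    - ((x * x') ^ i * (y * y') ^ l * ((x * y') ^ k - (x' * y) ^ k))"
    unfolding jd by (simp add: power_add power_mult_distrib algebra_simps)
  then show ?thesis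
    using diff_dvd_diff_powers[of "x * y'" "x' * y" k] by (metis dvd_minus_iff dvd_mult)
qed

text \<open>The right-hand side expands into the antisymmetric monomial differences of
  \<open>monomial_cross_dvd\<close>. This is nonexpansion before common factors of the values are
  removed.\<close>

lemma hom_eval_cross_dvd:
  "(x * y' - x' * y) dvd hom_eval d F x y * hom_eval d G x' y' - hom_eval d F x' y' * hom_eval d G x y"
proof -
  let ?m = "\<lambda>i j. x ^ i * y ^ (d - i) * (x' ^ j * y' ^ (d - j)) -
    x' ^ i * y' ^ (d - i) * (x ^ j * y ^ (d - j))"
  have "(x * y' - x' * y) dvd ?m i j" if "i \<le> d" "j \<le> d" for i j
  proof (cases "i \<le> j")
    case True
    then show ?thesis using that by (intro monomial_cross_dvd)
  next
    case False
    have "?m i j = - ?m j i" by (simp add: ac_simps)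
    then show ?thesis
      using monomial_cross_dvd[of j i d x y' x' y] False that by (metis dvd_minus_iff nle_le)
  qed
  then have "(x * y' - x' * y) dvd (\<Sum>i\<le>d. \<Sum>j\<le>d. coeff F i * coeff G j * ?m i j)"
    by (intro dvd_sum dvd_mult) auto
  also have "\<dots> = hom_eval d F x y * hom_eval d G x' y' - hom_eval d F x' y' * hom_eval d G x y"
    unfolding hom_eval_def sum_product sum_subtractf[symmetric]
    by (intro sum.cong refl) (simp add: algebra_simps)
  finally show ?thesis .
qed

text \<open>Rows of the Sylvester matrix are shifted coefficient lists of \<open>F\<close> and
  \<open>G\<close>. Paired with the monomials of degree \<open>2 * d - 1\<close>, they give the
  values of the forms times monomials of degree \<open>d - 1\<close>.\<close>

lemma sylvester_mult_monomials:
  fixes F G :: "'a::comm_ring_1 poly"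
  assumes "i < 2 * d"
  shows "(sylvester_mat_sub d d F G *\<^sub>v vec (2 * d) (\<lambda>j. x ^ (2 * d - 1 - j) * y ^ j)) $ i =
    (if i < d then x ^ (d - 1 - i) * y ^ i * hom_eval d F x y
     else x ^ (2 * d - 1 - i) * y ^ (i - d) * hom_eval d G x y)"
proof -
  let ?S = "sylvester_mat_sub d d F G"
  have "(?S *\<^sub>v vec (2 * d) (\<lambda>j. x ^ (2 * d - 1 - j) * y ^ j)) $ i =
    (\<Sum>j<2 * d. ?S $$ (i, j) * (x ^ (2 * d - 1 - j) * y ^ j))"
    using assms by (simp add: scalar_prod_def atLeast0LessThan)
  also have "\<dots> = (if i < d then x ^ (d - 1 - i) * y ^ i * hom_eval d F x y
     else x ^ (2 * d - 1 - i) * y ^ (i - d) * hom_eval d G x y)"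
  proof (cases "i < d")
    case True
    have "(\<Sum>j<2 * d. ?S $$ (i, j) * (x ^ (2 * d - 1 - j) * y ^ j)) =
      (\<Sum>j\<in>{i..d + i}. coeff F (d + i - j) * (x ^ (2 * d - 1 - j) * y ^ j))"
      using True by (intro sum.mono_neutral_cong_right) (auto simp: sylvester_mat_sub_index mult_2)
    also have "\<dots> = (\<Sum>k\<le>d. coeff F k * (x ^ (d - 1 - i + k) * y ^ (i + (d - k))))"
      using True by (intro sum.reindex_bij_witness[of _ "\<lambda>k. d + i - k" "\<lambda>j. d + i - j"]) (auto simp: mult_2)
    also have "\<dots> = x ^ (d - 1 - i) * y ^ i * hom_eval d F x y"
      unfolding hom_eval_def sum_distrib_left by (simp only: power_add ac_simps)
    finally show ?thesis using True by simp
  next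
    case False
    have "(\<Sum>j<2 * d. ?S $$ (i, j) * (x ^ (2 * d - 1 - j) * y ^ j)) =
      (\<Sum>j\<in>{i - d..i}. coeff G (i - j) * (x ^ (2 * d - 1 - j) * y ^ j))"
      using False assms by (intro sum.mono_neutral_cong_right) (auto simp: sylvester_mat_sub_index mult_2)
    also have "\<dots> = (\<Sum>k\<le>d. coeff G k * (x ^ (2 * d - 1 - i + k) * y ^ (i - d + (d - k))))"
      using False assms
      by (intro sum.reindex_bij_witness[of _ "\<lambda>k. i - k" "\<lambda>j. i - j"]) auto
    also have "\<dots> = x ^ (2 * d - 1 - i) * y ^ (i - d) * hom_eval d G x y"
      unfolding hom_eval_def sum_distrib_left by (simp only: power_add ac_simps)
    finally show ?thesis using False by simp
  qed
  finally show ?thesis .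
qed

text \<open>Multiplying the Sylvester system by the adjugate matrix turns it into the resultant
  times the vector of monomials.\<close>

lemma dvd_resultant_sub_mult_monomial:
  fixes F G :: "'a::comm_ring_1 poly"
  assumes "c dvd hom_eval d F x y" "c dvd hom_eval d G x y" and k: "k < 2 * d"
  shows "c dvd resultant_sub d d F G * (x ^ (2 * d - 1 - k) * y ^ k)"
proof -
  let ?S = "sylvester_mat_sub d d F G"
  define v where "v = vec (2 * d) (\<lambda>j. x ^ (2 * d - 1 - j) * y ^ j)"
  have S: "?S \<in> carrier_mat (2 * d) (2 * d)"
    using sylvester_mat_sub_carrier[of d d F G] by (simp add: mult_2)
  have v: "v \<in> carrier_vec (2 * d)" by (simp add: v_def)
  note adj = adj_mat[OF S]
  have "c dvd (?S *\<^sub>v v) $ i" if "i < 2 * d" for i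
    unfolding v_def sylvester_mult_monomials[OF that] using assms(1,2) by simp
  then have "c dvd (adj_mat ?S *\<^sub>v (?S *\<^sub>v v)) $ k"
    using adj(1) S k by (auto simp: scalar_prod_def intro!: dvd_sum)
  also have "adj_mat ?S *\<^sub>v (?S *\<^sub>v v) = (adj_mat ?S * ?S) *\<^sub>v v"
    using adj(1) S v by (simp add: assoc_mult_mat_vec)
  also have "\<dots> = det ?S \<cdot>\<^sub>v v"
    unfolding adj(3) using v by auto
  finally show ?thesis
    using k by (simp add: v_def resultant_sub_def)
qed

text \<open>A common zero modulo \<open>p\<close> kills the resultant: otherwise \<open>p\<close>
  would divide the extreme monomials \<open>x ^ (2 * d - 1)\<close> and
  \<open>y ^ (2 * d - 1)\<close>.\<close>

lemma prime_dvd_resultant_sub: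
  fixes p :: int
  assumes "prime p" "p dvd hom_eval d F x y" "p dvd hom_eval d G x y" "coprime x y" "d > 0"
  shows "p dvd resultant_sub d d F G"
proof (rule ccontr)
  assume "\<not> p dvd resultant_sub d d F G"
  moreover have "p dvd resultant_sub d d F G * x ^ (2 * d - 1)" "p dvd resultant_sub d d F G * y ^ (2 * d - 1)"
    using dvd_resultant_sub_mult_monomial[OF assms(2,3), of 0]
      dvd_resultant_sub_mult_monomial[OF assms(2,3), of "2 * d - 1"] \<open>d > 0\<close> by simp_all
  ultimately have "p dvd x" "p dvd y"
    using \<open>prime p\<close> by (auto simp: prime_dvd_mult_iff dest: prime_dvd_power)
  then show False
    using \<open>coprime x y\<close> \<open>prime p\<close> by (metis coprime_common_divisor not_prime_unit)
qed

section \<open>Clearing denominators\<close>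

lemma clear_denominators:
  assumes "prime p" "\<forall>i. coeff F i \<in> localization_at p"
  shows "\<exists>b F'. \<not> int p dvd b \<and> smult (of_int b) F = map_poly of_int F'"
  using assms(2)
proof (induction F)
  case 0
  show ?case using \<open>prime p\<close> by (intro exI[of _ 1] exI[of _ 0]) (auto simp: prime_gt_Suc_0_nat)
next
  case (pCons a F)
  have "\<forall>i. coeff F i \<in> localization_at p"
    using pCons.prems by (metis coeff_pCons_Suc)
  then obtain b F' where b: "\<not> int p dvd b" "smult (of_int b) F = map_poly of_int F'"
    using pCons.IH by blast
  have "a \<in> localization_at p"
    using pCons.prems by (metis coeff_pCons_0)
  then obtain x y where y: "a = of_int x / of_int y" "\<not> int p dvd y"
    unfolding localization_at_def by blast
  have "\<not> int p dvd y * b"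
    using b y \<open>prime p\<close> by (simp add: prime_dvd_mult_iff)
  moreover have "y \<noteq> 0" using y by auto
  then have "smult (of_int (y * b)) (pCons a F) = map_poly of_int (pCons (x * b) (smult y F'))"
    using b(2) y(1)
    by (simp add: of_int_hom.map_poly_pCons_hom of_int_hom.map_poly_hom_smult flip: smult_smult)
  ultimately show ?case by blast
qed

text \<open>Both forms are scaled by the same factor, so the map they define is unchanged.\<close>

lemma clear_denominators2:
  assumes "prime p" "\<forall>i. coeff F i \<in> localization_at p" "\<forall>i. coeff G i \<in> localization_at p"
  obtains b F' G' where "\<not> int p dvd b"
    "smult (of_int b) F = map_poly of_int F'" "smult (of_int b) G = map_poly of_int G'"
proof -
  obtain b F' where b: "\<not> int p dvd b" "smult (of_int b) F = map_poly of_int F'"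
    using clear_denominators[OF assms(1,2)] by blast
  obtain c G' where c: "\<not> int p dvd c" "smult (of_int c) G = map_poly of_int G'"
    using clear_denominators[OF assms(1,3)] by blast
  show thesis
  proof (rule that[of "b * c" "smult c F'" "smult b G'"])
    show "\<not> int p dvd b * c"
      using b c \<open>prime p\<close> by (simp add: prime_dvd_mult_iff)
    have "smult (of_int (b * c)) F = smult (of_int c) (smult (of_int b) F)" by (simp add: mult.commute)
    then show "smult (of_int (b * c)) F = map_poly of_int (smult c F')"
      by (simp add: b(2) of_int_hom.map_poly_hom_smult)
    have "smult (of_int (b * c)) G = smult (of_int b) (smult (of_int c) G)" by simp
    then show "smult (of_int (b * c)) G = map_poly of_int (smult b G')"
      by (simp add: c(2) of_int_hom.map_poly_hom_smult)
  qed
qed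

lemma form_eval_of_int:
  assumes "smult (of_int b) F = map_poly of_int F'"
  shows "of_int b * form_eval d F (of_int x) (of_int y) = (of_int (hom_eval d F' x y) :: 'a::field_char_0)"
proof -
  have "of_int b * of_rat (coeff F i) = (of_int (coeff F' i) :: 'a)" for i
  proof -
    have "of_int b * coeff F i = of_int (coeff F' i)"
      using arg_cong[OF assms, of "\<lambda>F. coeff F i"] by (simp add: coeff_map_poly)
    then have "of_rat (of_int b * coeff F i) = (of_rat (of_int (coeff F' i)) :: 'a)" by simp
    then show ?thesis by (simp add: of_rat_mult)
  qed
  then show ?thesis
    unfolding form_eval_def hom_eval_def sum_distrib_left of_int_sum
    by (intro sum.cong refl) (simp flip: mult.assoc)
qed

text \<open>Scaling both forms by \<open>b\<close> multiplies the determinant of size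
  \<open>2 * d\<close> by \<open>b ^ (d + d)\<close>, which is prime to \<open>p\<close>; the
  numerator of a unit is prime to \<open>p\<close> as well.\<close>

lemma not_dvd_resultant_sub:
  assumes p: "prime p" and unit: "unit_of_localization_at p (resultant_sub d d F G)"
    and b: "\<not> int p dvd b"
    and F': "smult (of_int b) F = map_poly of_int F'" "smult (of_int b) G = map_poly of_int G'"
  shows "\<not> int p dvd resultant_sub d d F' G'"
proof -
  let ?R = "resultant_sub d d F G"
  have "sylvester_mat_sub d d (smult (of_int b) F) (smult (of_int b) G) =
      of_int b \<cdot>\<^sub>m sylvester_mat_sub d d F G"
    by (rule eq_matI) (auto simp: sylvester_mat_sub_index)
  then have "of_int (resultant_sub d d F' G') = of_int b ^ (d + d) * ?R"
    unfolding resultant_sub_def of_int_hom.hom_det[symmetric]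
    by (simp add: sylvester_mat_sub_map flip: F')
  moreover obtain r s where s: "?R = of_int r / of_int s" "\<not> int p dvd s"
    using unit unfolding unit_of_localization_at_def localization_at_def by blast
  moreover have "s \<noteq> 0" using s by auto
  ultimately have "of_int (resultant_sub d d F' G' * s) = (of_int (b ^ (d + d) * r) :: rat)"
    by simp
  then have eq: "resultant_sub d d F' G' * s = b ^ (d + d) * r"
    by (simp only: of_int_eq_iff)
  obtain t w where w: "?R * (of_int t / of_int w) = 1" "\<not> int p dvd w"
    using unit unfolding unit_of_localization_at_def localization_at_def by blast
  moreover have "w \<noteq> 0" using w by auto
  ultimately have "of_int (r * t) = (of_int (s * w) :: rat)"
    using s \<open>s \<noteq> 0\<close> by (simp add: field_simps)
  then have "r * t = s * w" by (simp only: of_int_eq_iff)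
  then have "\<not> int p dvd r"
    using s w p by (metis dvd_mult2 prime_dvd_multD prime_nat_int_transfer)
  then have "\<not> int p dvd resultant_sub d d F' G' * s"
    unfolding eq using b p prime_dvd_power[of "int p" b "d + d"] by (auto simp: prime_dvd_mult_iff)
  then show ?thesis by auto
qed

section \<open>Integral representatives of rational points\<close>

lemma proj_point_eq_iff:
  assumes "(x, y) \<noteq> (0, 0)" "(x', y') \<noteq> (0, 0)"
  shows "proj_point x y = proj_point x' y' \<longleftrightarrow> x * y' = x' * (y :: 'a::field)"
proof -
  have "proj_rel u u" if "u \<noteq> (0, 0)" for u :: "'a \<times> 'a"
    using that unfolding proj_rel_def by (auto intro!: exI[of _ 1])
  then have "proj_point x y = proj_point x' y' \<longleftrightarrow> proj_rel (x, y) (x', y')"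
    unfolding proj_point_def using assms Quotient3_rel[OF Quotient3_P1] by blast
  also have "\<dots> \<longleftrightarrow> x * y' = x' * y"
  proof
    assume eq: "x * y' = x' * y"
    show "proj_rel (x, y) (x', y')"
    proof (cases "x = 0")
      case True
      then have "y \<noteq> 0" "x' = 0" "y' \<noteq> 0" using assms eq by auto
      then show ?thesis using assms True
        unfolding proj_rel_def by (auto intro!: exI[of _ "y' / y"])
    next
      case False
      then have "x' \<noteq> 0" using assms eq by auto
      then show ?thesis using assms False eq
        unfolding proj_rel_def by (auto intro!: exI[of _ "x' / x"] simp: field_simps)
    qed
  qed (auto simp: proj_rel_def)
  finally show ?thesis .
qed

abbreviation int_point :: "int \<Rightarrow> int \<Rightarrow> complex P1" where
  "int_point a b \<equiv> proj_point (of_int a) (of_int b)"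

lemma int_point_eq_iff:
  assumes "(a, b) \<noteq> (0, 0)" "(a', b') \<noteq> (0, 0)"
  shows "int_point a b = int_point a' b' \<longleftrightarrow> a * b' = a' * b"
proof -
  have "int_point a b = int_point a' b' \<longleftrightarrow> of_int (a * b') = (of_int (a' * b) :: complex)"
    using assms by (subst proj_point_eq_iff) simp_all
  then show ?thesis by (simp only: of_int_eq_iff)
qed

lemma coprime_not_both_0: "coprime a (b::int) \<Longrightarrow> (a, b) \<noteq> (0, 0)"
  by auto

lemma P1_rational_points_primitive:
  assumes "P \<in> P1_rational_points"
  obtains a b where "coprime a b" "P = int_point a b"
proof -
  obtain x y where xy: "P = proj_point (of_rat x) (of_rat y)" "(x, y) \<noteq> (0, 0)"
    using assms unfolding P1_rational_points_def by blast
  obtain k l where k: "x = of_int k / of_int l" "l \<noteq> 0"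
    using quotient_of_div[of x] quotient_of_denom_pos[of x] by (cases "quotient_of x") force
  obtain m n where m: "y = of_int m / of_int n" "n \<noteq> 0"
    using quotient_of_div[of y] quotient_of_denom_pos[of y] by (cases "quotient_of y") force
  have nz: "k * n \<noteq> 0 \<or> m * l \<noteq> 0" using xy(2) k m by auto
  obtain a b where ab: "k * n = a * gcd (k * n) (m * l)" "m * l = b * gcd (k * n) (m * l)" "coprime a b"
    using gcd_coprime_exists[of "k * n" "m * l"] nz by auto
  have "x * of_int b = y * of_int a"
  proof -
    have "k * n * b = m * l * a"
      by (subst ab(1), subst (2) ab(2)) (simp only: ac_simps)
    then have "of_int (k * n * b) = (of_int (m * l * a) :: rat)" by (simp only: of_int_eq_iff)
    moreover have "of_int k = x * of_int l" "of_int m = y * of_int n" using k m by simp_all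
    ultimately have "of_int l * of_int n * (x * of_int b) = of_int l * of_int n * (y * of_int a)"
      by (simp only: of_int_mult ac_simps)
    then show ?thesis using k(2) m(2) by simp
  qed
  then have "of_rat (x * of_int b) = (of_rat (of_int a * y) :: complex)" by (simp add: mult.commute)
  then have "P = int_point a b"
    unfolding xy(1) using xy(2) coprime_not_both_0[OF ab(3)]
    by (subst proj_point_eq_iff) (simp_all add: of_rat_mult)
  then show thesis using that ab(3) by blast
qed

lemma endomorphism_maps_rational_points:
  assumes "endomorphism_over_rat \<phi>" "P \<in> P1_rational_points"
  shows "\<phi> P \<in> P1_rational_points"
proof -
  obtain d F G where \<phi>: "given_by_forms \<phi> d F G"
    using assms(1) unfolding endomorphism_over_rat_def by blast
  obtain x y where P: "P = proj_point (of_rat x) (of_rat y)" "(x, y) \<noteq> (0, 0)"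
    using assms(2) unfolding P1_rational_points_def by blast
  have ev: "form_eval d H (of_rat x) (of_rat y) = (of_rat (form_eval d H x y) :: complex)" for H
    unfolding form_eval_def by (simp add: of_rat_sum of_rat_mult of_rat_power)
  have "(of_rat x, of_rat y) \<noteq> ((0, 0) :: complex \<times> complex)" using P(2) by simp
  with \<phi> have "\<phi> P = proj_point (of_rat (form_eval d F x y)) (of_rat (form_eval d G x y))"
    "(of_rat (form_eval d F x y), of_rat (form_eval d G x y)) \<noteq> ((0, 0) :: complex \<times> complex)"
    unfolding given_by_forms_def P(1) ev[symmetric] by blast+
  then show ?thesis unfolding P1_rational_points_def by auto
qed

text \<open>A Bezout identity \<open>s * u + t * v = 1\<close> provides the factor
  \<open>l = s * f + t * g\<close>.\<close>

lemma proportional_to_primitive: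
  fixes u v f g :: int
  assumes "coprime u v" "u * g = f * v"
  obtains l where "f = l * u" "g = l * v"
proof -
  obtain s t where st: "s * u + t * v = 1"
    using bezout_int[of u v] assms(1) by auto
  have "(s * f + t * g) * u = s * u * f + t * (u * g)" by (simp add: algebra_simps)
  also have "\<dots> = (s * u + t * v) * f" unfolding assms(2) by (simp add: algebra_simps)
  finally have f: "(s * f + t * g) * u = f" using st by simp
  have "(s * f + t * g) * v = s * (f * v) + t * v * g" by (simp add: algebra_simps)
  also have "\<dots> = (s * u + t * v) * g" unfolding assms(2)[symmetric] by (simp add: algebra_simps)
  finally have "(s * f + t * g) * v = g" using st by simp
  with f show thesis using that[of "s * f + t * g"] by simp
qed

section \<open>From good reduction at each prime to divisibility of integers\<close>

text \<open>For positive degree, the values of the integral forms are \<open>l\<close> and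
  \<open>l'\<close> times the primitive coordinates of the images. The resultant keeps both
  multipliers prime to \<open>p\<close>, so \<open>c = l * l'\<close> works in
  \<open>hom_eval_cross_dvd\<close>.\<close>

lemma good_reduction_cross_dvd:
  assumes p: "prime p" and good: "good_reduction_at p \<phi>"
    and cop: "coprime a b" "coprime a' b'" "coprime u v" "coprime u' v'"
    and \<phi>: "\<phi> (int_point a b) = int_point u v" "\<phi> (int_point a' b') = int_point u' v'"
  shows "\<exists>c. \<not> int p dvd c \<and> (a * b' - a' * b) dvd c * (u * v' - u' * v)"
proof -
  have p': "prime (int p)" using p by simp
  note nz = cop[THEN coprime_not_both_0]
  obtain d F G where forms: "given_by_forms \<phi> d F G"
    and loc: "\<forall>i. coeff F i \<in> localization_at p" "\<forall>i. coeff G i \<in> localization_at p"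
    and unit: "unit_of_localization_at p (resultant_sub d d F G)"
    using good unfolding good_reduction_at_def by blast
  obtain k F' G' where k: "\<not> int p dvd k"
    and F': "smult (of_int k) F = map_poly of_int F'" "smult (of_int k) G = map_poly of_int G'"
    using clear_denominators2[OF p loc] .
  have "k \<noteq> 0" using k by auto
  have scale: "\<exists>l. hom_eval d F' x y = l * z \<and> hom_eval d G' x y = l * w"
    if "coprime x y" "coprime z w" "\<phi> (int_point x y) = int_point z w" for x y z w
  proof -
    have "(of_int x, of_int y) \<noteq> ((0, 0) :: complex \<times> complex)" using coprime_not_both_0[OF that(1)] by simp
    then have *: "(form_eval d F (of_int x) (of_int y), form_eval d G (of_int x) (of_int y)) \<noteq> ((0, 0) :: complex \<times> complex)"
      "int_point z w = proj_point (form_eval d F (of_int x) (of_int y)) (form_eval d G (of_int x) (of_int y))"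
      using forms that(3) unfolding given_by_forms_def by auto
    have "of_int z * form_eval d G (of_int x) (of_int y) =
        form_eval d F (of_int x) (of_int y) * (of_int w :: complex)"
      using *(2) coprime_not_both_0[OF that(2)] by (subst (asm) proj_point_eq_iff[OF _ *(1)]) auto
    then have "of_int z * (of_int k * form_eval d G (of_int x) (of_int y)) =
        (of_int k * form_eval d F (of_int x) (of_int y)) * (of_int w :: complex)"
      by simp
    then have "z * hom_eval d G' x y = hom_eval d F' x y * w"
      unfolding form_eval_of_int[OF F'(1)] form_eval_of_int[OF F'(2)]
      by (simp only: of_int_eq_iff flip: of_int_mult)
    with that(2) show ?thesis by (metis proportional_to_primitive)
  qed
  obtain l where l: "hom_eval d F' a b = l * u" "hom_eval d G' a b = l * v"
    using scale cop(1,3) \<phi>(1) by blast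
  obtain l' where l': "hom_eval d F' a' b' = l' * u'" "hom_eval d G' a' b' = l' * v'"
    using scale cop(2,4) \<phi>(2) by blast
  show ?thesis
  proof (cases "d = 0")
    case True
    \<comment> \<open>The map is constant; its Sylvester matrix is empty and bounds nothing.\<close>
    then have "\<phi> (int_point a b) = \<phi> (int_point a' b')"
      using forms nz(1,2) unfolding given_by_forms_def form_eval_def by auto
    then have "u * v' - u' * v = 0"
      using \<phi> int_point_eq_iff[OF nz(3,4)] by simp
    moreover have "\<not> int p dvd 1" using p' by (metis not_prime_unit)
    ultimately show ?thesis by (metis dvd_0_right mult_zero_right)
  next
    case False
    have "\<not> int p dvd resultant_sub d d F' G'"
      by (rule not_dvd_resultant_sub[OF p unit k F'])
    then have "\<not> int p dvd l" "\<not> int p dvd l'"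
      using prime_dvd_resultant_sub[OF p' _ _ cop(1), of d F' G'] False l
        prime_dvd_resultant_sub[OF p' _ _ cop(2), of d F' G'] l' by auto
    then have "\<not> int p dvd l * l'" using p' by (simp add: prime_dvd_mult_iff)
    moreover have "(a * b' - a' * b) dvd l * l' * (u * v' - u' * v)"
      using hom_eval_cross_dvd[of a b' a' b d F' G'] unfolding l l' by (simp add: algebra_simps)
    ultimately show ?thesis by blast
  qed
qed

text \<open>A prime dividing \<open>m\<close> with \<open>gcd m n\<close> removed would have to
  divide the factor \<open>c\<close> belonging to that very prime.\<close>

lemma dvd_if_locally_dvd:
  fixes m n :: int
  assumes "\<And>p. prime p \<Longrightarrow> \<exists>c. \<not> int p dvd c \<and> m dvd c * n"
  shows "m dvd n"
proof (cases "m = 0")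
  case True
  \<comment> \<open>Any prime would do here: \<open>c \<noteq> 0\<close> and
    \<open>c * n = 0\<close> give \<open>n = 0\<close>.\<close>
  then show ?thesis using assms[OF two_is_prime_nat] by auto
next
  case False
  then obtain m' n' where mn: "m = m' * gcd m n" "n = n' * gcd m n" "coprime m' n'"
    using gcd_coprime_exists[of m n] by auto
  have "is_unit m'"
  proof (rule ccontr)
    assume "\<not> is_unit m'"
    moreover have "m' \<noteq> 0" using mn(1) False by auto
    ultimately obtain q where q: "q dvd m'" "prime q"
      using prime_divisor_exists by blast
    define p where "p = nat q"
    have p: "int p = q" "prime p"
      using q(2) prime_gt_0_int[OF q(2)] by (simp_all add: p_def)
    obtain c where c: "\<not> q dvd c" "m dvd c * n"
      using assms[OF p(2)] p(1) by auto
    have "m' * gcd m n dvd (c * n') * gcd m n"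
      using c(2) mn(1,2) by (metis mult.assoc)
    then have "m' dvd c * n'" using False by simp
    then have "m' dvd c" using mn(3) by (simp add: coprime_dvd_mult_left_iff)
    with q(1) c(1) show False by (meson dvd_trans)
  qed
  then have "m dvd gcd m n" by (subst mn(1)) (simp add: mult_unit_dvd_iff')
  then show ?thesis by simp
qed

theorem corollary1p2:
  fixes \<phi> :: "complex P1 \<Rightarrow> complex P1"
  assumes "endomorphism_over_rat \<phi>"
    and "\<And>p. prime p \<Longrightarrow> good_reduction_at p \<phi>"
  shows "(\<forall>P n. P \<in> P1_rational_points \<longrightarrow> periodic_point \<phi> P \<longrightarrow> minimal_period \<phi> P = n \<longrightarrow> n \<le> 3) \<and>
    (\<forall>P. P \<in> P1_rational_points \<longrightarrow> preperiodic_point \<phi> P \<longrightarrow>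
       finite (forward_orbit \<phi> P) \<and> card (forward_orbit \<phi> P) \<le> 12)"
proof -
  let ?S = P1_rational_points
  \<comment> \<open>Primitive coordinates are unique up to a common sign; any choice serves, as
    \<open>wdist\<close> takes absolute values.\<close>
  have "\<forall>P\<in>?S. \<exists>c. coprime (fst c) (snd c) \<and> P = int_point (fst c) (snd c)"
    by (metis P1_rational_points_primitive fst_conv snd_conv)
  then obtain c where c: "\<And>P. P \<in> ?S \<Longrightarrow> coprime (fst (c P)) (snd (c P))"
    "\<And>P. P \<in> ?S \<Longrightarrow> P = int_point (fst (c P)) (snd (c P))"
    by (metis (no_types))
  interpret primitive_coordinates ?S "\<lambda>P. fst (c P)" "\<lambda>P. snd (c P)"
  proof
    fix P Q assume PQ: "P \<in> ?S" "Q \<in> ?S" "fst (c P) * snd (c Q) = fst (c Q) * snd (c P)"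
    then show "P = Q"
      using int_point_eq_iff[OF c(1)[THEN coprime_not_both_0] c(1)[THEN coprime_not_both_0]] c(2)
      by metis
  qed (rule c(1))
  have \<phi>: "nonexpanding \<phi>"
    unfolding nonexpanding_def
  proof (intro conjI ballI)
    show maps: "\<phi> P \<in> ?S" if "P \<in> ?S" for P
      by (rule endomorphism_maps_rational_points[OF assms(1) that])
    fix P Q assume PQ: "P \<in> ?S" "Q \<in> ?S"
    note mem = PQ maps[OF PQ(1)] maps[OF PQ(2)]
    have "\<exists>k. \<not> int p dvd k \<and>
        (fst (c P) * snd (c Q) - fst (c Q) * snd (c P)) dvd
        k * (fst (c (\<phi> P)) * snd (c (\<phi> Q)) - fst (c (\<phi> Q)) * snd (c (\<phi> P)))" if "prime p" for p
      using that assms(2)[OF that] mem[THEN c(1)]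
      by (rule good_reduction_cross_dvd) (simp_all flip: mem[THEN c(2)])
    from dvd_if_locally_dvd[OF this] show "wdist P Q dvd wdist (\<phi> P) (\<phi> Q)"
      unfolding wdist_def by simp
  qed
  show ?thesis
    using minimal_period_le_3[OF \<phi> _ minimal_period(2,3)] card_orbit_le_12[OF \<phi>] by blast
qed

end
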